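(* Let $X\subset\mathbb{C}^2$ be a reduced algebraic curve and let $\Gamma$ be a local branch of $X$ at $p\in\operatorname{Sing}X$ with non-isotropic tangent line, where Euclidean coordinates are chosen such that $p=(0,0)$ and $\Gamma$ is parametrized by $x(t)=t^\alpha$, $y(t)=ct^\beta+\text{(higher order terms)}$, with $c\neq0$ and $\alpha<\beta$, so that $\Delta^{\mathrm{sing}}_p=\{u_1=0\}$ is the normal line of $\Gamma$ at $p$. Then the focal discriminant $\Delta^{\mathrm{focal}}$ (its local branch $u(t)$ associated to $\Gamma$, as $t\to0$) meets $\Delta_p^{\mathrm{sing}}$ in the focal point if $\beta\le2\alpha$, and at infinity if $\beta>2\alpha$. That is: if $\beta\le2\alpha$ then $u(t)$ tends to the focal point of $\Delta_p^{\mathrm{sing}}$ as $t\to0$, and if $\beta>2\alpha$ then $|u(t)|\to\infty$ as $t\to0$.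
   Context: For $u=(u_1,u_2)\in\mathbb{C}^2$, $D_u(x,y)=(x-u_1)^2+(y-u_2)^2$. A line is non-isotropic if its direction $(a,b)$ satisfies $a^2+b^2\neq0$. The local branch of $\Delta^{\mathrm{focal}}$ (the evolute) associated to $\Gamma$ is parametrized for small $t\neq0$ by $$u_1(t)=x(t)-y'(t)\frac{I(t)}{D(t)},\qquad u_2(t)=y(t)+x'(t)\frac{I(t)}{D(t)},$$ with $I(t)=x'(t)^2+y'(t)^2$ and $D(t)=x'(t)y''(t)-y'(t)x''(t)$; $u(t)$ is the unique centre for which $D_{u(t)}$ has a degenerate critical point at $(x(t),y(t))$. For $u\in\Delta_p^{\mathrm{sing}}=\{u_1=0\}$ the Morse number is $m_{p,\Gamma}(u)=\operatorname{ord}_t h(t,u)-\alpha+1$, where $h(t,u)=x'(t)(x(t)-u_1)+y'(t)(y(t)-u_2)$. The focal point on $\Delta_p^{\mathrm{sing}}$ is the exceptional point of this line where $m_{p,\Gamma}$ is larger than its generic value on the line (possibly infinite): it is $p=(0,0)$ if $\beta<2\alpha$ and $(0,\tfrac1{2c})$ if $\beta=2\alpha$; if $\beta>2\alpha$ there is no (finite) focal point. *)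

theory Defs
  imports
    "HOL-Complex_Analysis.Complex_Analysis"
    "HOL-Computational_Algebra.Squarefree"
    "HOL-Library.Extended_Nat"
begin

text \<open>
  A bivariate polynomial is a polynomial in the second coordinate \<open>y\<close> whose coefficients are
  polynomials in the first coordinate \<open>x\<close>. The affine curve \<open>P = 0\<close> is reduced when \<open>P\<close> is
  squarefree (this excludes \<open>P = 0\<close>); its singular points are then the common zeros of \<open>P\<close>
  and both partial derivatives.
\<close>

definition eval2 :: "complex poly poly \<Rightarrow> complex \<times> complex \<Rightarrow> complex" where
  "eval2 P z = poly (poly P [:snd z:]) (fst z)"

definition curve :: "complex poly poly \<Rightarrow> (complex \<times> complex) set" where
  "curve P = {z. eval2 P z = 0}"

definition Sing :: "complex poly poly \<Rightarrow> (complex \<times> complex) set" where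
  "Sing P = {z \<in> curve P. eval2 (map_poly pderiv P) z = 0 \<and> eval2 (pderiv P) z = 0}"

text \<open>
  A local branch of a plane curve at \<open>p\<close> is given by its normalization: a germ at \<open>0\<close> of an
  injective analytic map into the curve that sends \<open>0\<close> to \<open>p\<close>. The branch may be smooth
  (a singular point can have several smooth branches).
\<close>

definition parametrizes_branch ::
  "(complex \<Rightarrow> complex) \<Rightarrow> (complex \<Rightarrow> complex) \<Rightarrow> complex poly poly \<Rightarrow> complex \<times> complex \<Rightarrow> bool"
where
  "parametrizes_branch x y P p \<longleftrightarrow>
     (x 0, y 0) = p \<and>
     (\<exists>r>0. x holomorphic_on ball 0 r \<and> y holomorphic_on ball 0 r \<and>
        inj_on (\<lambda>t. (x t, y t)) (ball 0 r) \<and> (\<lambda>t. (x t, y t)) ` ball 0 r \<subseteq> curve P)"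

definition tangent_direction ::
  "(complex \<Rightarrow> complex) \<Rightarrow> (complex \<Rightarrow> complex) \<Rightarrow> complex \<times> complex \<Rightarrow> bool"
where
  "tangent_direction x y v \<longleftrightarrow> v \<noteq> 0 \<and>
     (\<exists>m. ((\<lambda>t. ((x t - x 0) / t ^ m, (y t - y 0) / t ^ m)) \<longlongrightarrow> v) (at 0))"

definition non_isotropic :: "complex \<times> complex \<Rightarrow> bool" where
  "non_isotropic v \<longleftrightarrow> (fst v)\<^sup>2 + (snd v)\<^sup>2 \<noteq> 0"

text \<open>
  Orthogonality is with respect to the complex bilinear form, not the Hermitian one.
\<close>

definition normal_line :: "complex \<times> complex \<Rightarrow> complex \<times> complex \<Rightarrow> (complex \<times> complex) set" where
  "normal_line p v = {u. fst v * (fst u - fst p) + snd v * (snd u - snd p) = 0}"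

definition sqdist :: "complex \<times> complex \<Rightarrow> complex \<times> complex \<Rightarrow> complex" where
  "sqdist u z = (fst z - fst u)\<^sup>2 + (snd z - snd u)\<^sup>2"

text \<open>
  The order of vanishing at \<open>0\<close> of a function that is analytic there, \<open>\<infinity>\<close> for the zero germ.
\<close>

definition ord0 :: "(complex \<Rightarrow> complex) \<Rightarrow> enat" where
  "ord0 f = (if \<forall>\<^sub>F t in nhds 0. f t = 0 then \<infinity> else enat (nat (zorder f 0)))"

definition h_fun ::
  "(complex \<Rightarrow> complex) \<Rightarrow> (complex \<Rightarrow> complex) \<Rightarrow> complex \<times> complex \<Rightarrow> complex \<Rightarrow> complex"
where
  "h_fun x y u t = deriv x t * (x t - fst u) + deriv y t * (y t - snd u)"

text \<open>
  The Morse number is \<open>ord h - \<alpha> + 1\<close>, where \<open>\<alpha>\<close> is the multiplicity of the branch. Since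
  always \<open>ord h \<ge> \<alpha> - 1\<close>, adding \<open>1\<close> first means that the subtraction on \<^typ>\<open>enat\<close> never
  truncates.
\<close>

definition morse_number ::
  "nat \<Rightarrow> (complex \<Rightarrow> complex) \<Rightarrow> (complex \<Rightarrow> complex) \<Rightarrow> complex \<times> complex \<Rightarrow> enat"
where
  "morse_number \<alpha> x y u = ord0 (h_fun x y u) + 1 - enat \<alpha>"

text \<open>
  The points of the line \<open>L\<close> at which the Morse number exceeds its generic value, i.e. the value
  taken at all but finitely many points of \<open>L\<close>.
\<close>

definition focal_points ::
  "nat \<Rightarrow> (complex \<Rightarrow> complex) \<Rightarrow> (complex \<Rightarrow> complex) \<Rightarrow> (complex \<times> complex) set \<Rightarrow>
   (complex \<times> complex) set"
where
  "focal_points \<alpha> x y L =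
     {u \<in> L. \<exists>k. finite {v \<in> L. morse_number \<alpha> x y v \<noteq> k} \<and> k < morse_number \<alpha> x y u}"

definition I_fun :: "(complex \<Rightarrow> complex) \<Rightarrow> (complex \<Rightarrow> complex) \<Rightarrow> complex \<Rightarrow> complex" where
  "I_fun x y t = (deriv x t)\<^sup>2 + (deriv y t)\<^sup>2"

definition D_fun :: "(complex \<Rightarrow> complex) \<Rightarrow> (complex \<Rightarrow> complex) \<Rightarrow> complex \<Rightarrow> complex" where
  "D_fun x y t = deriv x t * (deriv ^^ 2) y t - deriv y t * (deriv ^^ 2) x t"

definition focal_branch ::
  "(complex \<Rightarrow> complex) \<Rightarrow> (complex \<Rightarrow> complex) \<Rightarrow> complex \<Rightarrow> complex \<times> complex"
where
  "focal_branch x y t =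
     (x t - deriv y t * (I_fun x y t / D_fun x y t),
      y t + deriv x t * (I_fun x y t / D_fun x y t))"

text \<open>
  Where \<open>D \<noteq> 0\<close>, the point \<open>focal_branch x y t\<close> is the unique centre whose squared distance
  function, pulled back to the branch, has a degenerate critical point at \<open>t\<close>.
\<close>

lemma deriv_sqdist:
  assumes "x field_differentiable at s" "y field_differentiable at s"
  shows "deriv (\<lambda>s. sqdist u (x s, y s)) s = 2 * h_fun x y u s"
proof -
  have "(x has_field_derivative deriv x s) (at s)" "(y has_field_derivative deriv y s) (at s)"
    using assms by (simp_all add: DERIV_deriv_iff_field_differentiable)
  thus ?thesis
    unfolding sqdist_def h_fun_def
    by (intro DERIV_imp_deriv) (auto intro!: derivative_eq_intros simp: algebra_simps)
qed

lemma degenerate_critical_iff_focal_branch: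
  assumes x: "x analytic_on {t}" and y: "y analytic_on {t}" and D: "D_fun x y t \<noteq> 0"
  shows "deriv (\<lambda>s. sqdist u (x s, y s)) t = 0 \<and> (deriv ^^ 2) (\<lambda>s. sqdist u (x s, y s)) t = 0
         \<longleftrightarrow> u = focal_branch x y t"
proof -
  let ?f = "\<lambda>s. sqdist u (x s, y s)"
  let ?h' = "(deriv ^^ 2) x t * (x t - fst u) + (deriv ^^ 2) y t * (y t - snd u) + I_fun x y t"
  have "x field_differentiable at t" "y field_differentiable at t"
    "deriv x field_differentiable at t" "deriv y field_differentiable at t"
    using x y analytic_deriv analytic_on_imp_differentiable_at by blast+
  hence d: "(x has_field_derivative deriv x t) (at t)" "(y has_field_derivative deriv y t) (at t)"
    "(deriv x has_field_derivative (deriv ^^ 2) x t) (at t)"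
    "(deriv y has_field_derivative (deriv ^^ 2) y t) (at t)"
    by (simp_all add: DERIV_deriv_iff_field_differentiable numeral_2_eq_2)
  obtain S T where S: "open S" "t \<in> S" "x holomorphic_on S" and T: "open T" "t \<in> T" "y holomorphic_on T"
    using x y by (meson analytic_at)
  have "\<forall>\<^sub>F s in nhds t. s \<in> S \<inter> T"
    using S T by (intro eventually_nhds_in_open) auto
  hence ev: "\<forall>\<^sub>F s in nhds t. deriv ?f s = 2 * h_fun x y u s"
    by eventually_elim (use S T in \<open>auto intro!: deriv_sqdist holomorphic_on_imp_differentiable_at\<close>)
  have 1: "deriv ?f t = 2 * h_fun x y u t"
    using ev by (rule eventually_nhds_x_imp_x)
  have "(deriv ^^ 2) ?f t = deriv (\<lambda>s. 2 * h_fun x y u s) t"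
    using ev by (simp add: numeral_2_eq_2 deriv_cong_ev)
  also have "\<dots> = 2 * ?h'"
    using d unfolding h_fun_def I_fun_def
    by (intro DERIV_imp_deriv)
      (auto intro!: derivative_eq_intros simp: algebra_simps power2_eq_square)
  finally have 2: "(deriv ^^ 2) ?f t = 2 * ?h'" .
  have "h_fun x y u t = 0 \<and> ?h' = 0 \<longleftrightarrow>
        (x t - fst u) * D_fun x y t = deriv y t * I_fun x y t \<and>
        (y t - snd u) * D_fun x y t = - (deriv x t * I_fun x y t)" (is "?L \<longleftrightarrow> ?R")
  proof
    assume ?L
    thus ?R unfolding h_fun_def D_fun_def by algebra
  next
    assume R: ?R
    have "h_fun x y u t * D_fun x y t = 0" "?h' * D_fun x y t = 0"
      using R unfolding h_fun_def D_fun_def by algebra+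
    thus ?L using D by simp
  qed
  also have "\<dots> \<longleftrightarrow> u = focal_branch x y t"
    using D by (auto simp: focal_branch_def prod_eq_iff field_simps)
  finally show ?thesis
    unfolding 1 2 by (simp only: mult_eq_0_iff) simp
qed

end

theory Submission
  imports Defs
begin

text \<open>
  Both halves are computations of leading terms. On the line \<open>u\<^sub>1 = 0\<close> the power series of
  \<open>h(\<cdot>, u)\<close> is \<open>\<alpha> t\<^bsup>2\<alpha>-1\<^esup> + y'(t) (y(t) - u\<^sub>2)\<close>, and up to degree \<open>2\<beta> - 2\<close> only
  \<open>\<alpha> t\<^bsup>2\<alpha>-1\<^esup> - u\<^sub>2 y'(t)\<close> contributes; comparing \<open>2\<alpha> - 1\<close> with \<open>\<beta> - 1 = ord y'\<close> gives the focal
  point. For the evolute, \<open>t\<^bsup>\<beta>\<^esup> I / D \<sim> t\<^bsup>\<alpha>+1\<^esup> \<alpha> / (\<beta> (\<beta> - \<alpha>) c)\<close>, whence \<open>u\<^sub>1 \<rightarrow> 0\<close> and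
  \<open>t\<^bsup>\<beta>\<^esup> x' I / D \<sim> t\<^bsup>2\<alpha>\<^esup> \<alpha>\<^sup>2 / (\<beta> (\<beta> - \<alpha>) c)\<close>.
\<close>

section \<open>Leading coefficients of power series as limits\<close>

text \<open>Dividing by \<open>t ^ n\<close> shifts the series by \<open>n\<close> places, and the
  constant term of the shifted series is the limit. The coefficient at \<open>n\<close> may be
  zero.\<close>

lemma has_fps_expansion_tendsto_nth:
  fixes f :: "complex \<Rightarrow> complex"
  assumes f: "f has_fps_expansion F" and 0: "\<And>i. i < n \<Longrightarrow> fps_nth F i = 0"
  shows "((\<lambda>t. f t / t ^ n) \<longlongrightarrow> fps_nth F n) (at 0)"
proof (cases "F = 0")
  \<comment> \<open>The zero series is treated apart because \<open>subdegree 0 = 0\<close> gives no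
    bound on \<open>n\<close>.\<close>
  case True
  hence "\<forall>\<^sub>F t in at 0. f t = 0"
    using f eventually_nhds_conv_at by (auto simp: has_fps_expansion_0_iff)
  hence "\<forall>\<^sub>F t in at 0. f t / t ^ n = 0"
    by eventually_elim simp
  thus ?thesis
    using True by (simp add: tendsto_eventually)
next
  case False
  hence "n \<le> subdegree F"
    by (rule subdegree_geI) (use 0 in auto)
  from has_fps_expansion_shift[OF f this refl]
  have "((\<lambda>t. if t = 0 then fps_nth F n else f t / t ^ n) \<longlongrightarrow> fps_nth F n) (nhds 0)"
    by (auto dest: has_fps_expansion_imp_tendsto_0)
  hence "((\<lambda>t. if t = 0 then fps_nth F n else f t / t ^ n) \<longlongrightarrow> fps_nth F n) (at 0)"
    by (simp add: tendsto_nhds_iff)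
  thus ?thesis
    by (rule Lim_transform_eventually) (auto simp: eventually_at_filter)
qed

text \<open>The operator t d/dt multiplies the coefficient of degree n by n and keeps the degree, so
  n = 0 is no exception.\<close>

lemma has_fps_expansion_tendsto_deriv:
  fixes f :: "complex \<Rightarrow> complex"
  assumes f: "f has_fps_expansion F" and 0: "\<And>i. i < n \<Longrightarrow> fps_nth F i = 0"
  shows "((\<lambda>t. t * deriv f t / t ^ n) \<longlongrightarrow> of_nat n * fps_nth F n) (at 0)"
proof -
  have nth: "fps_nth (fps_X * fps_deriv F) i = of_nat i * fps_nth F i" for i
    by (cases i) auto
  have "(\<lambda>t. t * deriv f t) has_fps_expansion fps_X * fps_deriv F"
    by (intro fps_expansion_intros f)
  from has_fps_expansion_tendsto_nth[OF this, of n, unfolded nth] show ?thesis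
    using 0 by simp
qed

text \<open>Likewise t^2 d^2/dt^2 multiplies by n (n - 1). The factor is computed in the complex
  numbers and vanishes in degrees 0 and 1, which the second derivative kills.\<close>

lemma has_fps_expansion_tendsto_deriv2:
  fixes f :: "complex \<Rightarrow> complex"
  assumes f: "f has_fps_expansion F" and 0: "\<And>i. i < n \<Longrightarrow> fps_nth F i = 0"
  shows "((\<lambda>t. t\<^sup>2 * (deriv ^^ 2) f t / t ^ n) \<longlongrightarrow> of_nat n * (of_nat n - 1) * fps_nth F n) (at 0)"
proof -
  let ?F = "fps_X * (fps_X * fps_deriv (fps_deriv F))"
  have nth: "fps_nth ?F i = of_nat i * (of_nat i - 1) * fps_nth F i" for i
  proof (cases i)
    case (Suc j)
    thus ?thesis by (cases j) (auto simp: algebra_simps)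
  qed auto
  have "(\<lambda>t. t * (t * deriv (deriv f) t)) has_fps_expansion ?F"
    by (intro fps_expansion_intros f)
  from has_fps_expansion_tendsto_nth[OF this, of n, unfolded nth] show ?thesis
    using 0 by (simp add: eval_nat_numeral mult.assoc)
qed

section \<open>Orders of vanishing and generic Morse numbers\<close>

lemma ord0_fps_expansion:
  assumes "f has_fps_expansion F"
  shows "ord0 f = (if F = 0 then \<infinity> else enat (subdegree F))"
proof -
  have "(\<forall>\<^sub>F t in nhds 0. f t = 0) \<longleftrightarrow> F = 0"
  proof
    assume "\<forall>\<^sub>F t in nhds 0. f t = 0"
    hence "f has_fps_expansion 0"
      by (simp add: has_fps_expansion_0_iff)
    thus "F = 0"
      using assms fps_expansion_unique_complex by blast
  qed (use assms in \<open>auto simp: has_fps_expansion_0_iff\<close>)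
  thus ?thesis
    using has_fps_expansion_zorder_0[OF assms] by (simp add: ord0_def)
qed

lemma ord0_eqI:
  assumes "f has_fps_expansion F" "\<And>i. i < n \<Longrightarrow> fps_nth F i = 0" "fps_nth F n \<noteq> 0"
  shows "ord0 f = enat n"
proof -
  have "subdegree F = n" "F \<noteq> 0"
    using assms by (auto intro: subdegreeI)
  thus ?thesis
    using ord0_fps_expansion[OF assms(1)] by simp
qed

text \<open>Serves the focal point for \<beta> = 2 \<alpha>: there the order depends on higher terms
  of \<open>y\<close>, and it is infinite when the branch lies on a circle around that
  point.\<close>

lemma ord0_greaterI:
  assumes "f has_fps_expansion F" "\<And>i. i \<le> n \<Longrightarrow> fps_nth F i = 0"
  shows "enat n < ord0 f"
  using ord0_fps_expansion[OF assms(1)] assms(2) by (simp add: subdegree_greaterI)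

lemma morse_number_eqI:
  assumes "ord0 (h_fun x y u) = enat n"
  shows "morse_number \<alpha> x y u = enat (n + 1 - \<alpha>)"
  by (simp add: morse_number_def assms one_enat_def)

lemma morse_number_greaterI:
  assumes "enat n < ord0 (h_fun x y u)" "\<alpha> \<le> n + 1"
  shows "enat (n + 1 - \<alpha>) < morse_number \<alpha> x y u"
  using assms by (cases "ord0 (h_fun x y u)") (auto simp: morse_number_def one_enat_def)

lemma focal_points_generic:
  assumes "infinite L" "q \<in> L" "\<And>u. u \<in> L \<Longrightarrow> u \<noteq> q \<Longrightarrow> morse_number \<alpha> x y u = k"
  shows "focal_points \<alpha> x y L = (if k < morse_number \<alpha> x y q then {q} else {})"
proof -
  have "finite {u \<in> L. morse_number \<alpha> x y u \<noteq> k}"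
    by (rule finite_subset[of _ "{q}"]) (use assms in auto)
  moreover have "k' = k" if "finite {u \<in> L. morse_number \<alpha> x y u \<noteq> k'}" for k'
  proof (rule ccontr)
    assume "k' \<noteq> k"
    hence "L - {q} \<subseteq> {u \<in> L. morse_number \<alpha> x y u \<noteq> k'}"
      using assms by auto
    thus False
      using that assms(1) by (meson finite_subset infinite_remove)
  qed
  ultimately have "focal_points \<alpha> x y L = {u \<in> L. k < morse_number \<alpha> x y u}"
    unfolding focal_points_def by blast
  also have "\<dots> = {u. u = q \<and> k < morse_number \<alpha> x y q}"
    using assms(2,3) by (metis order.irrefl)
  finally show ?thesis
    by simp
qed

section \<open>Branches x = t^\<alpha>, y = c t^\<beta> + ... and their normal line\<close>

locale power_branch =
  fixes x y :: "complex \<Rightarrow> complex" and Y :: "complex fps" and c :: complex and \<alpha> \<beta> :: nat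
  assumes pos: "0 < \<alpha>" and less: "\<alpha> < \<beta>" and c: "c \<noteq> 0"
    and x_eq: "\<forall>\<^sub>F t in nhds 0. x t = t ^ \<alpha>"
    and y: "y has_fps_expansion Y" and Y0: "\<And>n. n < \<beta> \<Longrightarrow> fps_nth Y n = 0"
    and Yc: "fps_nth Y \<beta> = c"
begin

lemma x: "x has_fps_expansion fps_X ^ \<alpha>"
  using has_fps_expansion_cong[OF x_eq refl] has_fps_expansion_fps_X_power by blast

lemma y_tendsto: "((\<lambda>t. y t / t ^ \<beta>) \<longlongrightarrow> c) (at 0)"
  using has_fps_expansion_tendsto_nth[OF y Y0, of \<beta>] Yc by simp

lemma x_tendsto_0: "(x \<longlongrightarrow> 0) (at 0)"
  using has_fps_expansion_tendsto_nth[OF x, of 0] pos by simp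

lemma y_tendsto_0: "(y \<longlongrightarrow> 0) (at 0)"
  using has_fps_expansion_tendsto_nth[OF y, of 0] Y0[of 0] less by simp

text \<open>Since y is of smaller order than x, the factorisation below sends y / t^m to 0 without
  determining m. Hence \<open>snd v = 0\<close>, and \<open>v \<noteq> 0\<close> leaves
  \<open>fst v \<noteq> 0\<close>.\<close>

lemma normal_line_eq:
  assumes "tangent_direction x y v"
  shows "normal_line (0, 0) v = {u. fst u = 0}"
proof -
  obtain m where v: "v \<noteq> 0"
    and m: "((\<lambda>t. ((x t - x 0) / t ^ m, (y t - y 0) / t ^ m)) \<longlongrightarrow> v) (at 0)"
    using assms unfolding tangent_direction_def by blast
  have "x 0 = 0" "y 0 = 0"
    using has_fps_expansion_imp_0_eq_fps_nth_0[OF x] has_fps_expansion_imp_0_eq_fps_nth_0[OF y]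
      pos less Y0[of 0] by auto
  hence fst: "((\<lambda>t. x t / t ^ m) \<longlongrightarrow> fst v) (at 0)" and snd: "((\<lambda>t. y t / t ^ m) \<longlongrightarrow> snd v) (at 0)"
    using tendsto_fst[OF m] tendsto_snd[OF m] by simp_all
  have "((\<lambda>t. (x t / t ^ m) * (y t / t ^ \<beta>) * t ^ (\<beta> - \<alpha>)) \<longlongrightarrow> fst v * c * 0 ^ (\<beta> - \<alpha>)) (at 0)"
    by (intro tendsto_intros fst y_tendsto)
  moreover have "\<forall>\<^sub>F t in at 0. (x t / t ^ m) * (y t / t ^ \<beta>) * t ^ (\<beta> - \<alpha>) = y t / t ^ m"
  proof -
    have "\<forall>\<^sub>F t in at 0. t \<noteq> 0 \<and> x t = t ^ \<alpha>"
      using x_eq by (auto simp: eventually_at_filter elim: eventually_mono)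
    thus ?thesis
    proof eventually_elim
      case (elim t)
      have "t ^ \<alpha> * t ^ (\<beta> - \<alpha>) = t ^ \<beta>"
        using less by (simp flip: power_add)
      with elim show ?case by (simp add: field_simps)
    qed
  qed
  ultimately have "((\<lambda>t. y t / t ^ m) \<longlongrightarrow> fst v * c * 0 ^ (\<beta> - \<alpha>)) (at 0)"
    by (rule Lim_transform_eventually)
  hence "snd v = 0"
    using tendsto_unique[OF at_neq_bot snd] less by simp
  thus ?thesis
    using v by (auto simp: normal_line_def prod_eq_iff)
qed

section \<open>The Morse number along the normal line\<close>

definition h_fps :: "complex \<Rightarrow> complex fps" where
  "h_fps w = fps_deriv (fps_X ^ \<alpha>) * fps_X ^ \<alpha> + fps_deriv Y * (Y - fps_const w)"

lemma h_fun_has_fps_expansion: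
  assumes "fst u = 0"
  shows "h_fun x y u has_fps_expansion h_fps (snd u)"
proof -
  have "(\<lambda>t. deriv x t * x t + deriv y t * (y t - snd u)) has_fps_expansion h_fps (snd u)"
    unfolding h_fps_def by (intro fps_expansion_intros x y)
  thus ?thesis
    by (simp add: h_fun_def[abs_def] assms)
qed

text \<open>The product y y' starts in degree 2 \<beta> - 1 or later. The range below contains both
  competing degrees, 2 \<alpha> - 1 and \<beta> - 1.\<close>

lemma h_fps_nth:
  assumes "n < 2 * \<beta> - 1"
  shows "fps_nth (h_fps w) n =
    (if n = 2 * \<alpha> - 1 then of_nat \<alpha> else 0) - w * of_nat (n + 1) * fps_nth Y (n + 1)"
proof -
  have "\<alpha> - 1 + \<alpha> = 2 * \<alpha> - 1"
    using pos by simp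
  hence "fps_deriv (fps_X ^ \<alpha>) * fps_X ^ \<alpha> = fps_const (of_nat \<alpha>) * (fps_X ^ (2 * \<alpha> - 1) :: complex fps)"
    unfolding fps_deriv_power by (simp only: fps_deriv_fps_X mult_1_right mult.assoc flip: power_add)
  moreover have "fps_nth (fps_deriv Y * Y) n = 0"
    unfolding fps_mult_nth
  proof (intro sum.neutral ballI)
    fix i assume "i \<in> {0..n}"
    \<comment> \<open>Otherwise n + 1 = (i + 1) + (n - i) would be at least 2 \<beta>.\<close>
    hence "i + 1 < \<beta> \<or> n - i < \<beta>"
      using assms by auto
    thus "fps_nth (fps_deriv Y) i * fps_nth Y (n - i) = 0"
      using Y0 by auto
  qed
  ultimately show ?thesis
    by (simp add: h_fps_def ring_distribs)
qed

text \<open>The terms \<alpha> t^(2 \<alpha> - 1) and - w \<beta> c t^(\<beta> - 1) compete, with w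
  the second coordinate of the centre. If \<beta> < 2 \<alpha>, the second dominates unless w = 0;
  if \<beta> = 2 \<alpha>, they cancel exactly for 2 c w = 1; if \<beta> > 2 \<alpha>, the first
  dominates for all w.\<close>

lemma focal_points_eq:
  "focal_points \<alpha> x y {u. fst u = 0} =
     (if \<beta> < 2 * \<alpha> then {(0, 0)} else if \<beta> = 2 * \<alpha> then {(0, 1 / (2 * c))} else {})"
proof -
  let ?L = "{u :: complex \<times> complex. fst u = 0}"
  have "?L = {0} \<times> UNIV" by auto
  hence L: "infinite ?L"
    by (simp add: finite_cartesian_product_iff infinite_UNIV_char_0)
  note [simp] = h_fps_nth Y0 Yc
  note expansion = h_fun_has_fps_expansion
  consider "\<beta> < 2 * \<alpha>" | "\<beta> = 2 * \<alpha>" | "\<beta> > 2 * \<alpha>" by linarith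
  thus ?thesis
  proof cases
    case 1
    \<comment> \<open>The value stays unsimplified so that unification reads off the order \<beta> -
      1.\<close>
    have "morse_number \<alpha> x y u = enat (\<beta> - 1 + 1 - \<alpha>)" if "fst u = 0" "u \<noteq> (0, 0)" for u
      by (intro morse_number_eqI ord0_eqI[OF expansion])
        (use that 1 less c in \<open>auto simp: prod_eq_iff\<close>)
    moreover have "morse_number \<alpha> x y (0, 0) = enat (2 * \<alpha> - 1 + 1 - \<alpha>)"
      by (intro morse_number_eqI ord0_eqI[OF expansion])
        (use pos less in auto)
    ultimately show ?thesis
      using 1 pos less focal_points_generic[OF L, of "(0, 0)"] by simp
  next
    case 2
    let ?q = "(0, 1 / (2 * c))"
    have "morse_number \<alpha> x y u = enat (2 * \<alpha> - 1 + 1 - \<alpha>)" if "fst u = 0" "u \<noteq> ?q" for u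
      by (intro morse_number_eqI ord0_eqI[OF expansion])
        (use that 2 pos c Yc in \<open>auto simp: prod_eq_iff eq_divide_eq mult_ac\<close>)
    moreover have "enat (2 * \<alpha> - 1 + 1 - \<alpha>) < morse_number \<alpha> x y ?q"
      by (intro morse_number_greaterI ord0_greaterI[OF expansion])
        (use 2 pos c Yc in \<open>auto simp: le_less\<close>)
    ultimately show ?thesis
      using 2 pos focal_points_generic[OF L, of ?q] by simp
  next
    case 3
    have "morse_number \<alpha> x y u = enat (2 * \<alpha> - 1 + 1 - \<alpha>)" if "fst u = 0" for u
      by (intro morse_number_eqI ord0_eqI[OF expansion])
        (use that 3 pos in auto)
    \<comment> \<open>Every point of the line is generic here, so any choice of \<open>q\<close>
      yields the empty set.\<close>
    thus ?thesis
      using 3 focal_points_generic[OF L, of "(0, 0)"] by simp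
  qed
qed

section \<open>The evolute near t = 0\<close>

text \<open>
  Multiplying each derivative by \<open>t\<close> keeps the exponents \<open>\<alpha> - 1\<close>, \<open>\<alpha> - 2\<close>, \<open>\<alpha> + \<beta> - 3\<close>, whose
  subtractions on \<^typ>\<open>nat\<close> may truncate, out of the leading terms.
\<close>

definition A where "A t = t * deriv x t / t ^ \<alpha>"
definition B where "B t = t * deriv y t / t ^ \<beta>"
definition J where "J t = (t\<^sup>2 * I_fun x y t / t ^ (2 * \<alpha>)) / (t ^ 3 * D_fun x y t / t ^ (\<alpha> + \<beta>))"

lemma A_tendsto: "(A \<longlongrightarrow> of_nat \<alpha>) (at 0)"
  unfolding A_def[abs_def] using has_fps_expansion_tendsto_deriv[OF x, of \<alpha>] by simp

lemma B_tendsto: "(B \<longlongrightarrow> of_nat \<beta> * c) (at 0)"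
  unfolding B_def[abs_def] using has_fps_expansion_tendsto_deriv[OF y Y0, of \<beta>] Yc by simp

text \<open>In I the contribution of y' is negligible because \<alpha> < \<beta>. In D the two
  leading terms combine with the factor (\<beta> - 1) - (\<alpha> - 1) = \<beta> - \<alpha>, which
  is nonzero, so the quotient of the limits is legitimate.\<close>

lemma J_tendsto: "(J \<longlongrightarrow> of_nat \<alpha> / (of_nat \<beta> * (of_nat \<beta> - of_nat \<alpha>) * c)) (at 0)"
proof -
  have "((\<lambda>t. (A t)\<^sup>2 + (B t * t ^ (\<beta> - \<alpha>))\<^sup>2) \<longlongrightarrow> (of_nat \<alpha>)\<^sup>2 + (of_nat \<beta> * c * 0 ^ (\<beta> - \<alpha>))\<^sup>2) (at 0)"
    by (intro tendsto_intros A_tendsto B_tendsto)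
  moreover have "\<forall>\<^sub>F t in at 0. (A t)\<^sup>2 + (B t * t ^ (\<beta> - \<alpha>))\<^sup>2 = t\<^sup>2 * I_fun x y t / t ^ (2 * \<alpha>)"
  proof (rule eventually_at_filter[THEN iffD2], intro always_eventually allI impI)
    fix t :: complex assume t: "t \<noteq> 0"
    have "t ^ \<beta> = t ^ \<alpha> * t ^ (\<beta> - \<alpha>)"
      using less by (simp flip: power_add)
    hence "B t * t ^ (\<beta> - \<alpha>) = t * deriv y t / t ^ \<alpha>"
      using t by (simp add: B_def field_simps)
    moreover have "t ^ (2 * \<alpha>) = (t ^ \<alpha>)\<^sup>2"
      by (simp add: power_mult mult.commute)
    ultimately show "(A t)\<^sup>2 + (B t * t ^ (\<beta> - \<alpha>))\<^sup>2 = t\<^sup>2 * I_fun x y t / t ^ (2 * \<alpha>)"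
      by (simp add: A_def I_fun_def power_divide power_mult_distrib add_divide_distrib ring_distribs)
  qed
  ultimately have "((\<lambda>t. t\<^sup>2 * I_fun x y t / t ^ (2 * \<alpha>)) \<longlongrightarrow>
      (of_nat \<alpha>)\<^sup>2 + (of_nat \<beta> * c * 0 ^ (\<beta> - \<alpha>))\<^sup>2) (at 0)"
    by (rule Lim_transform_eventually)
  hence I: "((\<lambda>t. t\<^sup>2 * I_fun x y t / t ^ (2 * \<alpha>)) \<longlongrightarrow> (of_nat \<alpha>)\<^sup>2) (at 0)"
    using less by (simp add: power_0_left)
  have "((\<lambda>t. A t * (t\<^sup>2 * (deriv ^^ 2) y t / t ^ \<beta>) - B t * (t\<^sup>2 * (deriv ^^ 2) x t / t ^ \<alpha>)) \<longlongrightarrow>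
      of_nat \<alpha> * (of_nat \<beta> * (of_nat \<beta> - 1) * c) -
      of_nat \<beta> * c * (of_nat \<alpha> * (of_nat \<alpha> - 1) * 1)) (at 0)"
    using has_fps_expansion_tendsto_deriv2[OF x, of \<alpha>] has_fps_expansion_tendsto_deriv2[OF y Y0, of \<beta>]
    by (intro tendsto_intros A_tendsto B_tendsto) (simp_all add: Yc)
  also have "(\<lambda>t. A t * (t\<^sup>2 * (deriv ^^ 2) y t / t ^ \<beta>) - B t * (t\<^sup>2 * (deriv ^^ 2) x t / t ^ \<alpha>)) =
      (\<lambda>t. t ^ 3 * D_fun x y t / t ^ (\<alpha> + \<beta>))"
    by (auto simp: A_def B_def D_fun_def power_add diff_divide_distrib algebra_simps
        power2_eq_square power3_eq_cube)
  also have "of_nat \<alpha> * (of_nat \<beta> * (of_nat \<beta> - 1) * c) - of_nat \<beta> * c * (of_nat \<alpha> * (of_nat \<alpha> - 1) * 1) =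
      of_nat \<alpha> * (of_nat \<beta> * (of_nat \<beta> - of_nat \<alpha>) * c)"
    by (simp add: algebra_simps)
  finally have D: "((\<lambda>t. t ^ 3 * D_fun x y t / t ^ (\<alpha> + \<beta>)) \<longlongrightarrow>
      of_nat \<alpha> * (of_nat \<beta> * (of_nat \<beta> - of_nat \<alpha>) * c)) (at 0)" .
  have "(J \<longlongrightarrow> (of_nat \<alpha>)\<^sup>2 / (of_nat \<alpha> * (of_nat \<beta> * (of_nat \<beta> - of_nat \<alpha>) * c))) (at 0)"
    unfolding J_def[abs_def] by (intro tendsto_divide I D) (use pos less c in auto)
  thus ?thesis
    using pos by (simp add: power2_eq_square)
qed

text \<open>The exponents give (2 \<alpha> - 2) - (\<alpha> + \<beta> - 3) = \<alpha> + 1 - \<beta>.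
  Where D vanishes, both sides are 0 by the convention for division by zero.\<close>

lemma I_div_D:
  assumes "t \<noteq> 0"
  shows "I_fun x y t / D_fun x y t = t * t ^ \<alpha> * J t / t ^ \<beta>"
  using assms unfolding J_def mult_2 power_add power2_eq_square power3_eq_cube
  by (cases "D_fun x y t = 0") (simp_all add: field_simps)

text \<open>The quotient of powers is kept because the sign of 2 \<alpha> - \<beta> separates the
  cases.\<close>

lemma focal_branch_eq:
  assumes "t \<noteq> 0"
  shows "focal_branch x y t = (x t - t ^ \<alpha> * B t * J t, y t + t ^ (2 * \<alpha>) / t ^ \<beta> * A t * J t)"
  using assms unfolding focal_branch_def I_div_D[OF assms] A_def B_def mult_2 power_add
  by (simp add: field_simps)

lemma focal_branch_fst_tendsto: "((\<lambda>t. x t - t ^ \<alpha> * B t * J t) \<longlongrightarrow> 0) (at 0)"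
  by (rule tendsto_eq_intros refl x_tendsto_0 B_tendsto J_tendsto)+ (use pos in auto)

text \<open>The factor of t^(2 \<alpha> - \<beta>) in the leading term of u_2 - y; for \<beta> = 2
  \<alpha> it is the limit of u_2 itself.\<close>

definition l where "l = (of_nat \<alpha>)\<^sup>2 / (of_nat \<beta> * (of_nat \<beta> - of_nat \<alpha>) * c)"

lemma A_J_tendsto: "((\<lambda>t. A t * J t) \<longlongrightarrow> l) (at 0)"
  using tendsto_mult[OF A_tendsto J_tendsto] by (simp add: l_def power2_eq_square)

lemma focal_branch_tendsto:
  assumes "\<beta> \<le> 2 * \<alpha>"
  shows "(focal_branch x y \<longlongrightarrow> (if \<beta> < 2 * \<alpha> then (0, 0) else (0, 1 / (2 * c)))) (at 0)"
proof -
  \<comment> \<open>One limit covers both cases: \<open>0 ^ (2 * \<alpha> - \<beta>)\<close> is 1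
    for \<beta> = 2 \<alpha> and 0 for \<beta> < 2 \<alpha>.\<close>
  have "((\<lambda>t. (x t - t ^ \<alpha> * B t * J t, y t + t ^ (2 * \<alpha> - \<beta>) * (A t * J t))) \<longlongrightarrow>
      (0, 0 + 0 ^ (2 * \<alpha> - \<beta>) * l)) (at 0)"
    by (intro tendsto_intros focal_branch_fst_tendsto y_tendsto_0 A_J_tendsto)
  moreover have "\<forall>\<^sub>F t in at 0.
      (x t - t ^ \<alpha> * B t * J t, y t + t ^ (2 * \<alpha> - \<beta>) * (A t * J t)) = focal_branch x y t"
    using assms by (auto simp: eventually_at_filter focal_branch_eq power_diff mult.assoc)
  ultimately have "(focal_branch x y \<longlongrightarrow> (0, 0 + 0 ^ (2 * \<alpha> - \<beta>) * l)) (at 0)"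
    by (rule Lim_transform_eventually)
  moreover have "l = 1 / (2 * c)" if "\<beta> = 2 * \<alpha>"
    using that pos c unfolding l_def by (simp add: field_simps power2_eq_square)
  ultimately show ?thesis
    using assms by (auto simp: power_0_left split: if_splits)
qed

text \<open>With \<beta> > 2 \<alpha> the second coordinate is y plus a quotient whose numerator
  tends to \<open>l \<noteq> 0\<close> and whose denominator tends to 0; its norm bounds that of the
  pair from below.\<close>

lemma focal_branch_at_infinity:
  assumes "2 * \<alpha> < \<beta>"
  shows "filterlim (\<lambda>t. norm (focal_branch x y t)) at_top (at 0)"
proof -
  have "l \<noteq> 0"
    using pos less c by (simp add: l_def)
  hence "filterlim (\<lambda>t. A t * J t / t ^ (\<beta> - 2 * \<alpha>)) at_infinity (at 0)"
    using assms by (intro filterlim_divide_at_infinity[OF A_J_tendsto] filterlim_atI)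
      (auto intro!: tendsto_eq_intros simp: eventually_at_filter)
  hence "filterlim (\<lambda>t. y t + A t * J t / t ^ (\<beta> - 2 * \<alpha>)) at_infinity (at 0)"
    by (intro tendsto_add_filterlim_at_infinity[OF y_tendsto_0])
  hence "filterlim (\<lambda>t. norm (y t + A t * J t / t ^ (\<beta> - 2 * \<alpha>))) at_top (at 0)"
    by (rule filterlim_compose[OF filterlim_norm_at_top])
  moreover have "\<forall>\<^sub>F t in at 0. norm (y t + A t * J t / t ^ (\<beta> - 2 * \<alpha>)) \<le> norm (focal_branch x y t)"
  proof (rule eventually_at_filter[THEN iffD2], intro always_eventually allI impI)
    fix t :: complex assume "t \<noteq> 0"
    hence "snd (focal_branch x y t) = y t + A t * J t / t ^ (\<beta> - 2 * \<alpha>)"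
      using assms by (simp add: focal_branch_eq power_diff)
    thus "norm (y t + A t * J t / t ^ (\<beta> - 2 * \<alpha>)) \<le> norm (focal_branch x y t)"
      by (metis norm_snd_le prod.collapse)
  qed
  ultimately show ?thesis
    by (rule filterlim_at_top_mono)
qed

end

theorem corollary4p5:
  fixes P :: "complex poly poly" and x y :: "complex \<Rightarrow> complex" and Y :: "complex fps"
    and c :: complex and \<alpha> \<beta> :: nat and v :: "complex \<times> complex"
  assumes "squarefree P"
    and "(0, 0) \<in> Sing P"
    and "parametrizes_branch x y P (0, 0)"
    and "tangent_direction x y v" and "non_isotropic v"
    and "0 < \<alpha>" and "\<alpha> < \<beta>" and "c \<noteq> 0"
    and "\<forall>\<^sub>F t in nhds 0. x t = t ^ \<alpha>"
    and "y has_fps_expansion Y" and "\<forall>n<\<beta>. fps_nth Y n = 0" and "fps_nth Y \<beta> = c"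
  shows "normal_line (0, 0) v = {u. fst u = 0} \<and>
    (\<beta> \<le> 2 * \<alpha> \<longrightarrow>
       (\<exists>q. focal_points \<alpha> x y (normal_line (0, 0) v) = {q} \<and>
            q = (if \<beta> < 2 * \<alpha> then (0, 0) else (0, 1 / (2 * c))) \<and>
            (focal_branch x y \<longlongrightarrow> q) (at 0))) \<and>
    (\<beta> > 2 * \<alpha> \<longrightarrow>
       focal_points \<alpha> x y (normal_line (0, 0) v) = {} \<and>
       filterlim (\<lambda>t. norm (focal_branch x y t)) at_top (at 0))"
proof -
  interpret power_branch x y Y c \<alpha> \<beta>
    using assms(6-12) by unfold_locales auto
  show ?thesis
    unfolding normal_line_eq[OF assms(4)] focal_points_eq
    using focal_branch_tendsto focal_branch_at_infinity by auto
qed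

end
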